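(* Let $\mathbb{F}$ be a field of characteristic $0$ and let $W_\infty$ be the generalized Witt algebra in countably many variables $t_1,t_2,\ldots$ over $\mathbb{F}$, with basis $t^\alpha\frac{d}{dt_i}$, $\alpha\in\mathbb{Z}^\infty$, $i\in\mathbb{N}$. Let $\Phi: W_\infty\to W_\infty$ be the linear map determined by $$\Phi\Big(t^\alpha\frac{d}{dt_i}\Big)=t^{(0,\alpha)}\frac{d}{dt_{i+1}},\qquad i\in\mathbb{N},\ \alpha\in\mathbb{Z}^\infty .$$ Then $\Phi$ is both a local automorphism and a $2$-local automorphism of $W_\infty$, but $\Phi$ is not surjective; in particular $\Phi$ is not an automorphism of $W_\infty$.
   Context: $\mathbb{N}$ is the set of positive integers. $\mathbb{Z}^\infty$ denotes the group of finitely supported integer sequences $\alpha=(\alpha_1,\alpha_2,\ldots)$, $t^\alpha=\prod_i t_i^{\alpha_i}$, and $(0,\alpha)=(0,\alpha_1,\alpha_2,\ldots)$. With standard basis $\epsilon_1,\epsilon_2,\ldots$ of $\mathbb{Z}^\infty$, $W_\infty$ is the Lie algebra of derivations of $\mathbb{F}[t_1^{\pm1},t_2^{\pm1},\ldots]$ spanned by the $t^\alpha\frac{d}{dt_i}$ (finite linear combinations), where $\frac{d}{dt_i}$ is the partial derivative with respect to $t_i$. Equivalently, putting $\partial_i=t_i\frac{d}{dt_i}$, so that $t^\alpha\frac{d}{dt_i}=t^{\alpha-\epsilon_i}\partial_i$, it has basis $t^\alpha\partial_i$ and bracket $[t^\alpha\partial_i,t^\beta\partial_j]=t^{\alpha+\beta}(\beta_i\partial_j-\alpha_j\partial_i)$.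 An automorphism of a Lie algebra $L$ is an invertible linear map $\theta:L\to L$ with $\theta([x,y])=[\theta(x),\theta(y)]$ for all $x,y\in L$. A local automorphism of $L$ is a linear map $\Phi:L\to L$ such that for every $x\in L$ there is an automorphism $\theta_x$ of $L$ with $\Phi(x)=\theta_x(x)$. A $2$-local automorphism of $L$ is a map $\Phi:L\to L$ (not necessarily linear) such that for every $x,y\in L$ there is an automorphism $\theta_{x,y}$ of $L$ with $\Phi(x)=\theta_{x,y}(x)$ and $\Phi(y)=\theta_{x,y}(y)$. *)

theory Defs
  imports Complex_Main "HOL-Library.Poly_Mapping" "HOL-Library.Function_Algebras"
begin

text \<open>
  The variables are indexed by \<open>nat\<close> starting at \<open>0\<close>: the index \<open>i\<close> stands for the
  variable usually written with subscript \<open>i + 1\<close>.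
\<close>

type_synonym expo = "nat \<Rightarrow>\<^sub>0 int"

text \<open>
  Laurent polynomials are the group algebra of \<open>expo\<close>; the monomial with exponent \<open>\<alpha>\<close> is
  \<open>Poly_Mapping.single \<alpha> 1\<close>, and the multiplication of the library is convolution.
\<close>

type_synonym 'a laurent = "expo \<Rightarrow>\<^sub>0 'a"

lift_definition expo_shift :: "expo \<Rightarrow> expo"
  is "\<lambda>\<alpha> i. case i of 0 \<Rightarrow> 0 | Suc j \<Rightarrow> \<alpha> j"
proof -
  fix \<alpha> :: "nat \<Rightarrow> int"
  assume "finite {i. \<alpha> i \<noteq> 0}"
  then have "finite (Suc ` {i. \<alpha> i \<noteq> 0})" by simp
  then show "finite {i. (case i of 0 \<Rightarrow> 0 | Suc j \<Rightarrow> \<alpha> j) \<noteq> 0}"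
    by (rule rev_finite_subset) (auto simp: image_iff gr0_conv_Suc split: nat.splits)
qed

definition laurent_monom :: "expo \<Rightarrow> 'a::comm_ring_1 laurent"
  where "laurent_monom \<alpha> = Poly_Mapping.single \<alpha> 1"

definition laurent_const :: "'a::comm_ring_1 \<Rightarrow> 'a laurent"
  where "laurent_const c = Poly_Mapping.single 0 c"

definition partial :: "nat \<Rightarrow> 'a::comm_ring_1 laurent \<Rightarrow> 'a laurent"
  where "partial i p = (\<Sum>\<alpha>\<in>Poly_Mapping.keys p.
    Poly_Mapping.single (\<alpha> - Poly_Mapping.single i 1)
      (of_int (Poly_Mapping.lookup \<alpha> i) * Poly_Mapping.lookup p \<alpha>))"

lemma lookup_partial:
  "Poly_Mapping.lookup (partial i p) \<beta> =
    of_int (Poly_Mapping.lookup \<beta> i + 1) * Poly_Mapping.lookup p (\<beta> + Poly_Mapping.single i 1)"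
proof -
  have eq: "\<alpha> - Poly_Mapping.single i 1 = \<beta> \<longleftrightarrow> \<alpha> = \<beta> + Poly_Mapping.single i 1" for \<alpha>
    by (simp add: diff_eq_eq)
  have "Poly_Mapping.lookup (partial i p) \<beta> = (\<Sum>\<alpha>\<in>Poly_Mapping.keys p.
      if \<alpha> = \<beta> + Poly_Mapping.single i 1
      then of_int (Poly_Mapping.lookup \<alpha> i) * Poly_Mapping.lookup p \<alpha> else 0)"
    unfolding partial_def lookup_sum
    by (rule sum.cong) (auto simp: lookup_single when_def eq)
  also have "\<dots> = of_int (Poly_Mapping.lookup \<beta> i + 1)
      * Poly_Mapping.lookup p (\<beta> + Poly_Mapping.single i 1)"
    by (auto simp: sum.delta lookup_add in_keys_iff)
  finally show ?thesis .
qed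

lemma partial_add: "partial i (p + q) = partial i p + partial i q"
  by (rule poly_mapping_eqI) (simp add: lookup_partial lookup_add algebra_simps)

lemma partial_0 [simp]: "partial i 0 = 0"
  by (simp add: partial_def)

lemma partial_single:
  "partial i (Poly_Mapping.single \<alpha> c) =
    Poly_Mapping.single (\<alpha> - Poly_Mapping.single i 1) (of_int (Poly_Mapping.lookup \<alpha> i) * c)"
  by (cases "c = 0") (simp_all add: partial_def)

lemma poly_mapping_single_induct [case_names zero single add]:
  assumes "P 0" "\<And>\<alpha> c. P (Poly_Mapping.single \<alpha> c)"
    and "\<And>p q. P p \<Longrightarrow> P q \<Longrightarrow> P (p + q)"
  shows "P (p :: 'k \<Rightarrow>\<^sub>0 'b::comm_monoid_add)"
proof (induction p rule: update_induct)
  case const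
  then show ?case by (rule assms(1))
next
  case (update f a b)
  have "Poly_Mapping.update a b f = f + Poly_Mapping.single a b"
    using update(1)
    by (intro poly_mapping_eqI)
       (auto simp: lookup_update lookup_add lookup_single when_def in_keys_iff)
  then show ?case using update assms by simp
qed

lemma partial_mult: "partial i (p * q) = p * partial i q + partial i p * q"
proof (induction p rule: poly_mapping_single_induct)
  case (single \<alpha> c)
  show ?case
  proof (induction q rule: poly_mapping_single_induct)
    case (single \<beta> d)
    have "\<alpha> + (\<beta> - Poly_Mapping.single i 1) = \<alpha> + \<beta> - Poly_Mapping.single i 1"
      "\<alpha> - Poly_Mapping.single i 1 + \<beta> = \<alpha> + \<beta> - Poly_Mapping.single i 1"
      by (simp_all add: algebra_simps)
    then show ?case
      by (simp add: mult_single partial_single lookup_add single_add [symmetric] algebra_simps)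
  qed (simp_all add: partial_add algebra_simps)
qed (simp_all add: partial_add algebra_simps)

lemma partial_commute: "partial i (partial j p) = partial j (partial i p)"
proof (rule poly_mapping_eqI)
  fix \<beta>
  have "\<beta> + Poly_Mapping.single i 1 + Poly_Mapping.single j (1::int)
      = \<beta> + Poly_Mapping.single j 1 + Poly_Mapping.single i 1"
    by (simp add: algebra_simps)
  then show "Poly_Mapping.lookup (partial i (partial j p)) \<beta>
      = Poly_Mapping.lookup (partial j (partial i p)) \<beta>"
    unfolding lookup_partial
    by (cases "i = j") (simp_all add: lookup_add lookup_single when_def mult_ac add_ac)
qed

lemma laurent_const_add: "laurent_const (a + b) = laurent_const a + laurent_const b"
  by (simp add: laurent_const_def single_add)

lemma laurent_const_mult: "laurent_const (a * b) = laurent_const a * laurent_const b"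
  by (simp add: laurent_const_def mult_single)

lemma laurent_const_1 [simp]: "laurent_const 1 = 1"
  by (simp add: laurent_const_def)

lemma partial_const [simp]: "partial i (laurent_const c) = 0"
  by (simp add: laurent_const_def partial_single)

definition op_scale :: "'a::field \<Rightarrow> ('a laurent \<Rightarrow> 'a laurent) \<Rightarrow> 'a laurent \<Rightarrow> 'a laurent"
  where "op_scale c D = (\<lambda>p. laurent_const c * D p)"

global_interpretation laurent_op: vector_space op_scale
  by unfold_locales
    (auto simp: op_scale_def fun_eq_iff laurent_const_add laurent_const_mult algebra_simps)

text \<open>
  The operator below is \<open>t\<^sup>\<alpha> d/dt\<^sub>i\<close>; it differs from \<open>t\<^sup>\<alpha> \<partial>\<^sub>i\<close> with \<open>\<partial>\<^sub>i = t\<^sub>i d/dt\<^sub>i\<close> by a shift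
  of the exponent.
\<close>

definition basis_op :: "expo \<Rightarrow> nat \<Rightarrow> 'a::field laurent \<Rightarrow> 'a laurent"
  where "basis_op \<alpha> i = (\<lambda>p. laurent_monom \<alpha> * partial i p)"

definition witt_ops :: "('a::field laurent \<Rightarrow> 'a laurent) set"
  where "witt_ops = laurent_op.span {basis_op \<alpha> i |\<alpha> i. True}"

definition op_commutator :: "('a::field laurent \<Rightarrow> 'a laurent) \<Rightarrow>
    ('a laurent \<Rightarrow> 'a laurent) \<Rightarrow> 'a laurent \<Rightarrow> 'a laurent"
  where "op_commutator D E = (D \<circ> E) - (E \<circ> D)"

lemma witt_ops_derivation:
  assumes "D \<in> witt_ops"
  shows "D (p + q) = D p + D q" "D (laurent_const c * p) = laurent_const c * D p"
    "D (p * q) = p * D q + D p * q"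
proof -
  have "D (p + q) = D p + D q \<and> D (laurent_const c * p) = laurent_const c * D p \<and>
    D (p * q) = p * D q + D p * q"
    using assms unfolding witt_ops_def
  proof (induction rule: laurent_op.span_induct_alt)
    case base
    then show ?case by simp
  next
    case (step a x y)
    then show ?case
      by (auto simp: op_scale_def basis_op_def partial_add partial_mult algebra_simps)
  qed
  then show "D (p + q) = D p + D q" "D (laurent_const c * p) = laurent_const c * D p"
    "D (p * q) = p * D q + D p * q" by auto
qed

lemma op_commutator_basis:
  "op_commutator (basis_op \<alpha> i) (basis_op \<beta> j) =
    op_scale (of_int (Poly_Mapping.lookup \<beta> i)) (basis_op (\<alpha> + \<beta> - Poly_Mapping.single i 1) j) -
    op_scale (of_int (Poly_Mapping.lookup \<alpha> j)) (basis_op (\<alpha> + \<beta> - Poly_Mapping.single j 1) i)"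
proof
  fix p :: "'a laurent"
  have 1: "laurent_monom \<alpha> * partial i (laurent_monom \<beta> :: 'a laurent) =
      laurent_const (of_int (Poly_Mapping.lookup \<beta> i)) *
        laurent_monom (\<alpha> + \<beta> - Poly_Mapping.single i 1)" for \<alpha> \<beta> i
    by (simp add: laurent_monom_def laurent_const_def partial_single mult_single add_diff_eq
        del: single_of_int)
  have "op_commutator (basis_op \<alpha> i) (basis_op \<beta> j) p =
      (laurent_monom \<alpha> * partial i (laurent_monom \<beta>)) * partial j p -
      (laurent_monom \<beta> * partial j (laurent_monom \<alpha>)) * partial i p"
    by (simp add: op_commutator_def basis_op_def partial_mult partial_commute [of i j]
        algebra_simps)
  then show "op_commutator (basis_op \<alpha> i) (basis_op \<beta> j) p = (
    op_scale (of_int (Poly_Mapping.lookup \<beta> i)) (basis_op (\<alpha> + \<beta> - Poly_Mapping.single i 1) j) -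
    op_scale (of_int (Poly_Mapping.lookup \<alpha> j)) (basis_op (\<alpha> + \<beta> - Poly_Mapping.single j 1) i)) p"
    unfolding 1 by (simp add: op_scale_def basis_op_def mult.assoc add.commute [of \<beta> \<alpha>])
qed

lemma basis_op_in: "basis_op \<alpha> i \<in> witt_ops"
  unfolding witt_ops_def by (rule laurent_op.span_base) auto

lemma op_commutator_in:
  fixes D E :: "'a::field laurent \<Rightarrow> 'a laurent"
  assumes D: "D \<in> witt_ops" and E: "E \<in> witt_ops"
  shows "op_commutator D E \<in> witt_ops"
proof -
  have sub: "laurent_op.subspace witt_ops"
    by (simp add: witt_ops_def)
  have gen: "op_commutator (basis_op \<alpha> i) E \<in> witt_ops" for \<alpha> i
    using E unfolding witt_ops_def
  proof (induction rule: laurent_op.span_induct_alt)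
    case base
    have "op_commutator (basis_op \<alpha> i) 0 = (0 :: 'a laurent \<Rightarrow> 'a laurent)"
      by (auto simp: op_commutator_def basis_op_def fun_eq_iff)
    then show ?case using laurent_op.subspace_0[OF sub] by (simp only: witt_ops_def)
  next
    case (step c x y)
    then obtain \<beta> j where x: "x = basis_op \<beta> j" by auto
    have eq: "op_commutator (basis_op \<alpha> i) (op_scale c x + y) =
        op_scale c (op_commutator (basis_op \<alpha> i) x) + op_commutator (basis_op \<alpha> i) y"
      by (auto simp: op_commutator_def op_scale_def fun_eq_iff right_diff_distrib
          witt_ops_derivation(1,2)[OF basis_op_in])
    have "op_commutator (basis_op \<alpha> i) x \<in> witt_ops"
      unfolding x op_commutator_basis
      by (intro laurent_op.subspace_diff[OF sub] laurent_op.subspace_scale[OF sub] basis_op_in)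
    then show ?case
      using step.IH unfolding eq witt_ops_def [symmetric]
      by (intro laurent_op.subspace_add[OF sub] laurent_op.subspace_scale[OF sub])
  qed
  show ?thesis
    using D unfolding witt_ops_def
  proof (induction rule: laurent_op.span_induct_alt)
    case base
    have "E 0 = 0" using witt_ops_derivation(1)[OF E, of 0 0] by (metis add.right_neutral add_left_cancel)
    then have "op_commutator 0 E = 0"
      by (auto simp: op_commutator_def fun_eq_iff)
    then show ?case using laurent_op.subspace_0[OF sub] by (simp only: witt_ops_def)
  next
    case (step c x y)
    then obtain \<beta> j where x: "x = basis_op \<beta> j" by auto
    have eq: "op_commutator (op_scale c x + y) E =
        op_scale c (op_commutator x E) + op_commutator y E"
      by (auto simp: op_commutator_def op_scale_def fun_eq_iff right_diff_distrib
          witt_ops_derivation(1,2)[OF E])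
    show ?case
      using step.IH gen[of \<beta> j] unfolding eq witt_ops_def [symmetric] x [symmetric]
      by (intro laurent_op.subspace_add[OF sub] laurent_op.subspace_scale[OF sub])
  qed
qed

typedef (overloaded) 'a witt = "witt_ops :: ('a::field laurent \<Rightarrow> 'a laurent) set"
  morphisms witt_apply Abs_witt
  using basis_op_in by blast

setup_lifting type_definition_witt

instantiation witt :: (field) ab_group_add
begin

lift_definition zero_witt :: "'a witt" is "0"
  by (simp add: witt_ops_def laurent_op.span_zero)

lift_definition plus_witt :: "'a witt \<Rightarrow> 'a witt \<Rightarrow> 'a witt" is "(+)"
  by (simp add: witt_ops_def laurent_op.span_add)

lift_definition minus_witt :: "'a witt \<Rightarrow> 'a witt \<Rightarrow> 'a witt" is "(-)"
  by (simp add: witt_ops_def laurent_op.span_diff)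

lift_definition uminus_witt :: "'a witt \<Rightarrow> 'a witt" is "uminus"
  by (simp add: witt_ops_def laurent_op.span_neg)

instance
proof
  fix a b c :: "'a witt"
  show "a + b + c = a + (b + c)" by transfer (rule add.assoc)
  show "a + b = b + a" by transfer (rule add.commute)
  show "0 + a = a" by transfer (rule add_0_left)
  show "- a + a = 0" by transfer (rule ab_left_minus)
  show "a - b = a + - b" by transfer (rule diff_conv_add_uminus)
qed

end

lift_definition witt_scale :: "'a::field \<Rightarrow> 'a witt \<Rightarrow> 'a witt" is op_scale
  by (simp add: witt_ops_def laurent_op.span_scale)

lift_definition witt_bracket :: "'a::field witt \<Rightarrow> 'a witt \<Rightarrow> 'a witt" is op_commutator
  by (rule op_commutator_in)

lift_definition witt_basis :: "expo \<Rightarrow> nat \<Rightarrow> 'a::field witt" is basis_op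
  by (rule basis_op_in)

lemma witt_bracket_basis:
  "witt_bracket (witt_basis \<alpha> i) (witt_basis \<beta> j) =
    witt_scale (of_int (Poly_Mapping.lookup \<beta> i))
      (witt_basis (\<alpha> + \<beta> - Poly_Mapping.single i 1) j) -
    witt_scale (of_int (Poly_Mapping.lookup \<alpha> j))
      (witt_basis (\<alpha> + \<beta> - Poly_Mapping.single j 1) i)"
  by (simp only: witt_apply_inject [symmetric] witt_bracket.rep_eq witt_basis.rep_eq
      witt_scale.rep_eq minus_witt.rep_eq op_commutator_basis)

global_interpretation witt: vector_space witt_scale
proof
  fix a b :: 'a and x y :: "'a witt"
  show "witt_scale a (x + y) = witt_scale a x + witt_scale a y"
    by transfer (rule laurent_op.scale_right_distrib)
  show "witt_scale (a + b) x = witt_scale a x + witt_scale b x"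
    by transfer (rule laurent_op.scale_left_distrib)
  show "witt_scale a (witt_scale b x) = witt_scale (a * b) x"
    by transfer (rule laurent_op.scale_scale)
  show "witt_scale 1 x = x"
    by transfer (rule laurent_op.scale_one)
qed

definition lie_automorphism ::
    "('k::field \<Rightarrow> 'l::ab_group_add \<Rightarrow> 'l) \<Rightarrow> ('l \<Rightarrow> 'l \<Rightarrow> 'l) \<Rightarrow> ('l \<Rightarrow> 'l) \<Rightarrow> bool"
  where "lie_automorphism scale bracket \<theta> \<longleftrightarrow>
    Vector_Spaces.linear scale scale \<theta> \<and> bij \<theta> \<and>
    (\<forall>x y. \<theta> (bracket x y) = bracket (\<theta> x) (\<theta> y))"

definition local_automorphism ::
    "('k::field \<Rightarrow> 'l::ab_group_add \<Rightarrow> 'l) \<Rightarrow> ('l \<Rightarrow> 'l \<Rightarrow> 'l) \<Rightarrow> ('l \<Rightarrow> 'l) \<Rightarrow> bool"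
  where "local_automorphism scale bracket \<Phi> \<longleftrightarrow>
    Vector_Spaces.linear scale scale \<Phi> \<and>
    (\<forall>x. \<exists>\<theta>. lie_automorphism scale bracket \<theta> \<and> \<Phi> x = \<theta> x)"

definition two_local_automorphism ::
    "('k::field \<Rightarrow> 'l::ab_group_add \<Rightarrow> 'l) \<Rightarrow> ('l \<Rightarrow> 'l \<Rightarrow> 'l) \<Rightarrow> ('l \<Rightarrow> 'l) \<Rightarrow> bool"
  where "two_local_automorphism scale bracket \<Phi> \<longleftrightarrow>
    (\<forall>x y. \<exists>\<theta>. lie_automorphism scale bracket \<theta> \<and> \<Phi> x = \<theta> x \<and> \<Phi> y = \<theta> y)"

definition witt_shift :: "('a::field witt \<Rightarrow> 'a witt) \<Rightarrow> bool"
  where "witt_shift \<Phi> \<longleftrightarrow> Vector_Spaces.linear witt_scale witt_scale \<Phi> \<and>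
    (\<forall>\<alpha> i. \<Phi> (witt_basis \<alpha> i) = witt_basis (expo_shift \<alpha>) (Suc i))"

end

theory Submission
  imports Defs
begin

text \<open>
  Every element of \<open>W\<^sub>\<infinity>\<close> involves only finitely many variables, and on finitely many
  variables the shift \<open>t\<^sub>i \<mapsto> t\<^sub>i\<^sub>+\<^sub>1\<close> is the restriction of a permutation of all variables.
  A permutation of the variables acts on Laurent polynomials by ring automorphisms, and
  conjugation by such an automorphism is an automorphism of the Lie algebra
  (\<open>witt_perm_automorphism\<close>).

  Let \<open>\<theta>\<^sub>N\<close> be the automorphism attached to the cycle \<open>0 \<mapsto> 1 \<mapsto> \<dots> \<mapsto> N \<mapsto> 0\<close>.  For each
  fixed \<open>x\<close> the sequence \<open>\<theta>\<^sub>N x\<close> is eventually constant, and its eventual value is the shift of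
  \<open>x\<close> (\<open>eventually_cycle_eq_shift\<close>).  Thus the shift is a pointwise limit of automorphisms in
  the discrete topology.  This one fact yields the existence of the shift (the limit of linear
  maps is linear), that it is a local automorphism (one large \<open>N\<close> serves for \<open>x\<close>), and that it
  is a 2-local automorphism (one large \<open>N\<close> serves for both \<open>x\<close> and \<open>y\<close>).

  Surjectivity is lost in the limit: all derivations in the image of the shift annihilate the
  first variable \<open>t\<^sub>0\<close>, whereas \<open>d/dt\<^sub>0\<close> does not.
\<close>

section \<open>Permutations of the variables acting on Laurent polynomials\<close>

text \<open>
  In a semigroup ring, a change of exponents along an additive bijection is a ring isomorphism:
  by bilinearity it is enough to compare products of monomials.
\<close>

lemma map_key_mult:
  fixes p q :: "'k::monoid_add \<Rightarrow>\<^sub>0 'b::semiring_0"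
  assumes f: "bij f" and add: "\<And>x y. f (x + y) = f x + f y"
  shows "Poly_Mapping.map_key f (p * q) = Poly_Mapping.map_key f p * Poly_Mapping.map_key f q"
proof -
  have inj: "inj f" using f by (rule bij_is_inj)
  show ?thesis
  proof (induction p rule: poly_mapping_single_induct)
    case (single k c)
    obtain a where k: "k = f a" using f by (metis bij_pointE)
    show ?case
    proof (induction q rule: poly_mapping_single_induct)
      case (single l d)
      obtain b where l: "l = f b" using f by (metis bij_pointE)
      show ?case
        unfolding k l by (simp add: mult_single add [symmetric] map_key_single inj)
    qed (simp_all add: map_key_plus inj distrib_left)
  qed (simp_all add: map_key_plus inj distrib_right)
qed

lemma map_key_inv:
  assumes "bij f"
  shows "Poly_Mapping.map_key f (Poly_Mapping.map_key (inv f) p) = p"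
    and "Poly_Mapping.map_key (inv f) (Poly_Mapping.map_key f q) = q"
  using assms
  by (auto intro!: poly_mapping_eqI
      simp: map_key.rep_eq bij_is_inj bij_imp_bij_inv bij_is_surj surj_f_inv_f)

lemma bij_map_key:
  assumes "bij f"
  shows "bij (Poly_Mapping.map_key f)"
  by (rule o_bij [where g = "Poly_Mapping.map_key (inv f)"])
    (simp_all add: fun_eq_iff map_key_inv assms)

text \<open>
  The coefficient of \<open>t\<^sup>\<beta>\<close> in the image of \<open>p\<close> is the coefficient of \<open>t\<^sup>\<beta>\<^sup>\<circ>\<^sup>\<tau>\<close> in \<open>p\<close>; this is
  the substitution \<open>t\<^sub>i \<mapsto> t\<^bsub>\<tau> i\<^esub>\<close>.
\<close>

definition permute_vars :: "(nat \<Rightarrow> nat) \<Rightarrow> 'a::zero laurent \<Rightarrow> 'a laurent"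
  where "permute_vars \<tau> = Poly_Mapping.map_key (Poly_Mapping.map_key \<tau>)"

lemma lookup_permute_vars:
  "bij \<tau> \<Longrightarrow> Poly_Mapping.lookup (permute_vars \<tau> p) \<beta> =
    Poly_Mapping.lookup p (Poly_Mapping.map_key \<tau> \<beta>)"
  by (simp add: permute_vars_def map_key.rep_eq bij_map_key bij_is_inj)

lemma permute_vars_single:
  assumes "bij \<tau>"
  shows "permute_vars \<tau> (Poly_Mapping.single (Poly_Mapping.map_key \<tau> \<beta>) c) =
    Poly_Mapping.single \<beta> c"
  unfolding permute_vars_def by (rule map_key_single) (simp add: assms bij_map_key bij_is_inj)

lemma permute_vars_inv:
  assumes "bij \<tau>"
  shows "permute_vars \<tau> (permute_vars (inv \<tau>) p) = p"
    and "permute_vars (inv \<tau>) (permute_vars \<tau> p) = p"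
  using assms
  by (auto intro!: poly_mapping_eqI simp: lookup_permute_vars bij_imp_bij_inv map_key_inv)

lemma permute_vars_add:
  fixes p q :: "'a::comm_ring_1 laurent"
  shows "bij \<tau> \<Longrightarrow> permute_vars \<tau> (p + q) = permute_vars \<tau> p + permute_vars \<tau> q"
  by (auto intro!: poly_mapping_eqI simp: lookup_permute_vars lookup_add)

lemma permute_vars_diff:
  fixes p q :: "'a::comm_ring_1 laurent"
  shows "bij \<tau> \<Longrightarrow> permute_vars \<tau> (p - q) = permute_vars \<tau> p - permute_vars \<tau> q"
  by (auto intro!: poly_mapping_eqI simp: lookup_permute_vars lookup_minus)

lemma permute_vars_0: "bij \<tau> \<Longrightarrow> permute_vars \<tau> 0 = 0"
  by (auto intro!: poly_mapping_eqI simp: lookup_permute_vars)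

lemma permute_vars_mult:
  fixes p q :: "'a::comm_ring_1 laurent"
  shows "bij \<tau> \<Longrightarrow> permute_vars \<tau> (p * q) = permute_vars \<tau> p * permute_vars \<tau> q"
  unfolding permute_vars_def
  by (rule map_key_mult) (simp_all add: bij_map_key map_key_plus bij_is_inj)

lemma permute_vars_const:
  assumes "bij \<tau>"
  shows "permute_vars \<tau> (laurent_const c) = laurent_const c"
  using permute_vars_single [OF assms, of 0] by (simp add: laurent_const_def assms bij_is_inj)

lemma permute_vars_partial:
  fixes p :: "'a::comm_ring_1 laurent"
  assumes "bij \<tau>"
  shows "permute_vars \<tau> (partial i p) = partial (\<tau> i) (permute_vars \<tau> p)"
  using assms
  by (intro poly_mapping_eqI)
    (simp add: lookup_permute_vars lookup_partial map_key_plus map_key_single map_key.rep_eq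
      bij_is_inj)

section \<open>The induced automorphisms of the Witt algebra\<close>

definition conj_perm :: "(nat \<Rightarrow> nat) \<Rightarrow> ('a::zero laurent \<Rightarrow> 'a laurent) \<Rightarrow>
    'a laurent \<Rightarrow> 'a laurent"
  where "conj_perm \<tau> D = permute_vars \<tau> \<circ> D \<circ> permute_vars (inv \<tau>)"

lemma conj_perm_add:
  fixes D E :: "'a::comm_ring_1 laurent \<Rightarrow> 'a laurent"
  shows "bij \<tau> \<Longrightarrow> conj_perm \<tau> (D + E) = conj_perm \<tau> D + conj_perm \<tau> E"
  by (auto simp: conj_perm_def permute_vars_add fun_eq_iff)

lemma conj_perm_scale:
  "bij \<tau> \<Longrightarrow> conj_perm \<tau> (op_scale c D) = op_scale c (conj_perm \<tau> D)"
  by (auto simp: conj_perm_def op_scale_def permute_vars_mult permute_vars_const fun_eq_iff)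

lemma conj_perm_commutator:
  "bij \<tau> \<Longrightarrow> conj_perm \<tau> (op_commutator D E) =
    op_commutator (conj_perm \<tau> D) (conj_perm \<tau> E)"
  by (auto simp: conj_perm_def op_commutator_def permute_vars_diff permute_vars_inv fun_eq_iff)

lemma conj_perm_basis:
  assumes "bij \<tau>"
  shows "conj_perm \<tau> (basis_op (Poly_Mapping.map_key \<tau> \<beta>) i) = basis_op \<beta> (\<tau> i)"
  using assms
  by (auto simp: conj_perm_def basis_op_def laurent_monom_def permute_vars_mult
      permute_vars_partial permute_vars_single permute_vars_inv fun_eq_iff)

lemma conj_perm_in:
  fixes D :: "'a::field laurent \<Rightarrow> 'a laurent"
  assumes \<tau>: "bij \<tau>" and "D \<in> witt_ops"
  shows "conj_perm \<tau> D \<in> witt_ops"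
  using assms(2) unfolding witt_ops_def
proof (induction rule: laurent_op.span_induct_alt)
  case base
  have "conj_perm \<tau> (0 :: 'a laurent \<Rightarrow> 'a laurent) = 0"
    using \<tau> by (auto simp: conj_perm_def permute_vars_0 fun_eq_iff)
  then show ?case by (simp only: laurent_op.span_zero)
next
  case (step c D E)
  then obtain \<alpha> i where D: "D = basis_op \<alpha> i" by auto
  have "conj_perm \<tau> D = basis_op (Poly_Mapping.map_key (inv \<tau>) \<alpha>) (\<tau> i)"
    using conj_perm_basis [OF \<tau>, of "Poly_Mapping.map_key (inv \<tau>) \<alpha>" i]
    by (simp add: D map_key_inv \<tau>)
  then show ?case
    using step.IH unfolding conj_perm_add [OF \<tau>] conj_perm_scale [OF \<tau>]
    by (intro laurent_op.span_add laurent_op.span_scale) (auto intro: laurent_op.span_base)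
qed

definition witt_perm :: "(nat \<Rightarrow> nat) \<Rightarrow> 'a::field witt \<Rightarrow> 'a witt"
  where "witt_perm \<tau> x = Abs_witt (conj_perm \<tau> (witt_apply x))"

lemma witt_apply_perm:
  "bij \<tau> \<Longrightarrow> witt_apply (witt_perm \<tau> x) = conj_perm \<tau> (witt_apply x)"
  unfolding witt_perm_def by (intro Abs_witt_inverse conj_perm_in witt_apply)

lemma witt_perm_add: "bij \<tau> \<Longrightarrow> witt_perm \<tau> (x + y) = witt_perm \<tau> x + witt_perm \<tau> y"
  by (simp add: witt_apply_inject [symmetric] witt_apply_perm plus_witt.rep_eq conj_perm_add)

lemma witt_perm_0: "bij \<tau> \<Longrightarrow> witt_perm \<tau> 0 = 0"
  using witt_perm_add [of \<tau> 0 0] by simp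

lemma witt_perm_scale: "bij \<tau> \<Longrightarrow> witt_perm \<tau> (witt_scale c x) = witt_scale c (witt_perm \<tau> x)"
  by (simp add: witt_apply_inject [symmetric] witt_apply_perm witt_scale.rep_eq conj_perm_scale)

lemma witt_perm_basis:
  "bij \<tau> \<Longrightarrow> witt_perm \<tau> (witt_basis (Poly_Mapping.map_key \<tau> \<beta>) i) = witt_basis \<beta> (\<tau> i)"
  by (simp add: witt_apply_inject [symmetric] witt_apply_perm witt_basis.rep_eq conj_perm_basis)

lemma witt_perm_inv:
  assumes "bij \<tau>"
  shows "witt_perm \<tau> (witt_perm (inv \<tau>) x) = x" "witt_perm (inv \<tau>) (witt_perm \<tau> x) = x"
  using assms
  by (simp_all add: witt_apply_inject [symmetric] witt_apply_perm bij_imp_bij_inv)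
    (simp_all add: conj_perm_def fun_eq_iff permute_vars_inv inv_inv_eq)

lemma linear_witt_iff:
  "Vector_Spaces.linear witt_scale witt_scale \<Phi> \<longleftrightarrow>
    (\<forall>x y. \<Phi> (x + y) = \<Phi> x + \<Phi> y) \<and> (\<forall>c x. \<Phi> (witt_scale c x) = witt_scale c (\<Phi> x))"
  by (simp add: linear_iff_module_hom module_hom_iff witt.module_axioms)

text \<open>
  Conjugation respects composition of operators, hence commutators; conjugation by the inverse
  permutation is the inverse map.
\<close>

lemma witt_perm_automorphism:
  assumes "bij \<tau>"
  shows "lie_automorphism witt_scale witt_bracket (witt_perm \<tau> :: 'a::field witt \<Rightarrow> 'a witt)"
proof -
  have "bij (witt_perm \<tau> :: 'a witt \<Rightarrow> 'a witt)"
    by (rule o_bij [where g = "witt_perm (inv \<tau>)"])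
      (simp_all add: fun_eq_iff witt_perm_inv assms)
  moreover have "witt_perm \<tau> (witt_bracket x y) = witt_bracket (witt_perm \<tau> x) (witt_perm \<tau> y)"
    for x y :: "'a witt"
    by (simp add: witt_apply_inject [symmetric] witt_apply_perm witt_bracket.rep_eq
        conj_perm_commutator assms)
  ultimately show ?thesis
    by (simp add: lie_automorphism_def linear_witt_iff witt_perm_add witt_perm_scale assms)
qed

lemma witt_induct [case_names zero step]:
  fixes x :: "'a::field witt"
  assumes zero: "P 0"
    and step: "\<And>c \<alpha> i y. P y \<Longrightarrow> P (witt_scale c (witt_basis \<alpha> i) + y)"
  shows "P x"
proof -
  have "\<exists>y. witt_apply y = D \<and> P y" if "D \<in> witt_ops" for D :: "'a laurent \<Rightarrow> 'a laurent"
    using that unfolding witt_ops_def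
  proof (induction rule: laurent_op.span_induct_alt)
    case base
    then show ?case using zero zero_witt.rep_eq by blast
  next
    case (step c D E)
    then obtain \<alpha> i y where "D = basis_op \<alpha> i" "witt_apply y = E" "P y" by auto
    then show ?case
      using assms(2)
      by (intro exI [of _ "witt_scale c (witt_basis \<alpha> i) + y"])
        (simp add: plus_witt.rep_eq witt_scale.rep_eq witt_basis.rep_eq)
  qed
  then show ?thesis using witt_apply [of x] by (metis witt_apply_inject)
qed

section \<open>The shift as a limit of cycles\<close>

definition cycle_upto :: "nat \<Rightarrow> nat \<Rightarrow> nat"
  where "cycle_upto N i = (if i < N then Suc i else if i = N then 0 else i)"

lemma bij_cycle_upto: "bij (cycle_upto N)"
proof (rule o_bij)
  let ?g = "\<lambda>j. if j = 0 then N else if j \<le> N then j - 1 else j"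
  show "?g \<circ> cycle_upto N = id" "cycle_upto N \<circ> ?g = id"
    by (auto simp: cycle_upto_def fun_eq_iff)
qed

text \<open>
  The wrap-around \<open>N \<mapsto> 0\<close> goes unnoticed by an exponent that does not involve \<open>t\<^sub>N\<close>, and the
  variables beyond \<open>N\<close>, which the cycle leaves in place instead of shifting, must not occur
  either.
\<close>

lemma map_key_cycle_shift:
  assumes "\<And>i. N \<le> i \<Longrightarrow> Poly_Mapping.lookup \<alpha> i = 0"
  shows "Poly_Mapping.map_key (cycle_upto N) (expo_shift \<alpha>) = \<alpha>"
proof (rule poly_mapping_eqI)
  fix i
  show "Poly_Mapping.lookup (Poly_Mapping.map_key (cycle_upto N) (expo_shift \<alpha>)) i =
      Poly_Mapping.lookup \<alpha> i"
    using assms [of i] assms [of "i - 1"]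
    by (auto simp: map_key.rep_eq bij_is_inj bij_cycle_upto expo_shift.rep_eq cycle_upto_def
        split: nat.split)
qed

lemma eventually_cycle_basis:
  "\<forall>\<^sub>F N in sequentially.
    witt_perm (cycle_upto N) (witt_basis \<alpha> i) = witt_basis (expo_shift \<alpha>) (Suc i)"
proof -
  obtain M where M: "\<And>j. j \<in> Poly_Mapping.keys \<alpha> \<Longrightarrow> j < M"
    using finite_nat_set_iff_bounded finite_keys by metis
  have "witt_perm (cycle_upto N) (witt_basis \<alpha> i) = witt_basis (expo_shift \<alpha>) (Suc i)"
    if "max M (Suc i) \<le> N" for N
  proof -
    have "Poly_Mapping.lookup \<alpha> j = 0" if "N \<le> j" for j
      using M [of j] that \<open>max M (Suc i) \<le> N\<close> by (auto simp: in_keys_iff)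
    then have "Poly_Mapping.map_key (cycle_upto N) (expo_shift \<alpha>) = \<alpha>"
      by (rule map_key_cycle_shift)
    moreover have "cycle_upto N i = Suc i"
      using that by (simp add: cycle_upto_def)
    ultimately show ?thesis
      using witt_perm_basis [OF bij_cycle_upto, of N "expo_shift \<alpha>" i] by simp
  qed
  then show ?thesis unfolding eventually_sequentially by blast
qed

text \<open>
  The eventual values of the \<open>\<theta>\<^sub>N x\<close> depend linearly on \<open>x\<close>, which constructs the shift without
  any appeal to the linear independence of the \<open>t\<^sup>\<alpha> d/dt\<^sub>i\<close>.
\<close>

lemma witt_shift_exists: "\<exists>\<Phi> :: 'a::field witt \<Rightarrow> 'a witt. witt_shift \<Phi>"
proof -
  have "\<exists>y. \<forall>\<^sub>F N in sequentially. witt_perm (cycle_upto N) x = y" for x :: "'a witt"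
  proof (induction x rule: witt_induct)
    case zero
    show ?case by (auto simp: witt_perm_0 bij_cycle_upto)
  next
    case (step c \<alpha> i y)
    then obtain z where "\<forall>\<^sub>F N in sequentially. witt_perm (cycle_upto N) y = z" by blast
    with eventually_cycle_basis [where 'a = 'a and \<alpha> = \<alpha> and i = i]
    have "\<forall>\<^sub>F N in sequentially. witt_perm (cycle_upto N) (witt_scale c (witt_basis \<alpha> i) + y) =
        witt_scale c (witt_basis (expo_shift \<alpha>) (Suc i)) + z"
      by (rule eventually_elim2) (simp add: witt_perm_add witt_perm_scale bij_cycle_upto)
    then show ?case by blast
  qed
  then obtain \<Phi> :: "'a witt \<Rightarrow> 'a witt"
    where \<Phi>: "\<And>x. \<forall>\<^sub>F N in sequentially. witt_perm (cycle_upto N) x = \<Phi> x" by metis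
  have "\<Phi> (x + y) = \<Phi> x + \<Phi> y" for x y
  proof -
    have "\<forall>\<^sub>F N in sequentially. \<Phi> (x + y) = \<Phi> x + \<Phi> y"
      using \<Phi> [of "x + y"] \<Phi> [of x] \<Phi> [of y]
      by eventually_elim (simp add: witt_perm_add bij_cycle_upto)
    then show ?thesis by simp
  qed
  moreover have "\<Phi> (witt_scale c x) = witt_scale c (\<Phi> x)" for c x
  proof -
    have "\<forall>\<^sub>F N in sequentially. \<Phi> (witt_scale c x) = witt_scale c (\<Phi> x)"
      using \<Phi> [of "witt_scale c x"] \<Phi> [of x]
      by eventually_elim (simp add: witt_perm_scale bij_cycle_upto)
    then show ?thesis by simp
  qed
  moreover have "\<Phi> (witt_basis \<alpha> i) = witt_basis (expo_shift \<alpha>) (Suc i)" for \<alpha> i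
  proof -
    have "\<forall>\<^sub>F N in sequentially. \<Phi> (witt_basis \<alpha> i) = witt_basis (expo_shift \<alpha>) (Suc i)"
      using \<Phi> [of "witt_basis \<alpha> i"] eventually_cycle_basis [where 'a = 'a and \<alpha> = \<alpha> and i = i]
      by eventually_elim simp
    then show ?thesis by simp
  qed
  ultimately show ?thesis
    unfolding witt_shift_def linear_witt_iff by blast
qed

lemma witt_shift_simps:
  assumes "witt_shift \<Phi>"
  shows "\<Phi> (x + y) = \<Phi> x + \<Phi> y" "\<Phi> (witt_scale c x) = witt_scale c (\<Phi> x)" "\<Phi> 0 = 0"
    "\<Phi> (witt_basis \<alpha> i) = witt_basis (expo_shift \<alpha>) (Suc i)"
proof -
  show add: "\<Phi> (x + y) = \<Phi> x + \<Phi> y" for x y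
    using assms by (simp add: witt_shift_def linear_witt_iff)
  show "\<Phi> 0 = 0" using add [of 0 0] by simp
qed (use assms in \<open>simp_all add: witt_shift_def linear_witt_iff\<close>)

lemma eventually_cycle_eq_shift:
  fixes \<Phi> :: "'a::field witt \<Rightarrow> 'a witt"
  assumes \<Phi>: "witt_shift \<Phi>"
  shows "\<forall>\<^sub>F N in sequentially. witt_perm (cycle_upto N) x = \<Phi> x"
proof (induction x rule: witt_induct)
  case zero
  show ?case by (simp add: witt_perm_0 bij_cycle_upto witt_shift_simps [OF \<Phi>])
next
  case (step c \<alpha> i y)
  from eventually_cycle_basis [where 'a = 'a and \<alpha> = \<alpha> and i = i] step show ?case
    by (rule eventually_elim2)
      (simp add: witt_perm_add witt_perm_scale bij_cycle_upto witt_shift_simps [OF \<Phi>])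
qed

lemma witt_shift_unique:
  assumes "witt_shift \<Phi>" "witt_shift \<Psi>"
  shows "\<Phi> = \<Psi>"
proof
  fix x
  show "\<Phi> x = \<Psi> x"
    by (induction x rule: witt_induct) (simp_all add: witt_shift_simps assms)
qed

lemma witt_shift_two_local:
  assumes "witt_shift \<Phi>"
  shows "two_local_automorphism witt_scale witt_bracket \<Phi>"
  unfolding two_local_automorphism_def
proof (intro allI)
  fix x y
  have "\<forall>\<^sub>F N in sequentially.
      witt_perm (cycle_upto N) x = \<Phi> x \<and> witt_perm (cycle_upto N) y = \<Phi> y"
    by (intro eventually_conj eventually_cycle_eq_shift assms)
  then obtain N where "witt_perm (cycle_upto N) x = \<Phi> x" "witt_perm (cycle_upto N) y = \<Phi> y"
    unfolding eventually_sequentially by blast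
  then show "\<exists>\<theta>. lie_automorphism witt_scale witt_bracket \<theta> \<and> \<Phi> x = \<theta> x \<and> \<Phi> y = \<theta> y"
    using witt_perm_automorphism [OF bij_cycle_upto] by metis
qed

section \<open>Failure of surjectivity\<close>

lemma partial_var:
  "partial i (laurent_monom (Poly_Mapping.single j 1)) = (if i = j then 1 else 0)"
  by (auto simp: laurent_monom_def partial_single lookup_single when_def)

lemma laurent_monom_0: "laurent_monom 0 = 1"
  by (simp add: laurent_monom_def)

lemma witt_shift_kills_first_var:
  assumes "witt_shift \<Phi>"
  shows "witt_apply (\<Phi> x) (laurent_monom (Poly_Mapping.single 0 1)) = 0"
proof (induction x rule: witt_induct)
  case zero
  then show ?case by (simp add: witt_shift_simps assms zero_witt.rep_eq)
next
  case (step c \<alpha> i y)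
  then show ?case
    by (simp add: witt_shift_simps assms plus_witt.rep_eq witt_scale.rep_eq witt_basis.rep_eq
        op_scale_def basis_op_def partial_var del: single_one)
qed

lemma witt_shift_not_surj:
  fixes \<Phi> :: "'a::field witt \<Rightarrow> 'a witt"
  assumes "witt_shift \<Phi>"
  shows "\<not> surj \<Phi>"
proof
  assume "surj \<Phi>"
  then obtain x where "\<Phi> x = witt_basis 0 0" by (metis surjD)
  then have "witt_apply (witt_basis 0 0 :: 'a witt) (laurent_monom (Poly_Mapping.single 0 1)) = 0"
    using witt_shift_kills_first_var [OF assms, of x] by simp
  then show False
    by (simp add: witt_basis.rep_eq basis_op_def partial_var laurent_monom_0 del: single_one)
qed

section \<open>The shift is local and 2-local but not an automorphism\<close>

theorem mainTheorem4:
  "(\<exists>!\<Phi> :: 'a::field_char_0 witt \<Rightarrow> 'a witt. witt_shift \<Phi>) \<and>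
   (\<forall>\<Phi> :: 'a witt \<Rightarrow> 'a witt. witt_shift \<Phi> \<longrightarrow>
      local_automorphism witt_scale witt_bracket \<Phi> \<and>
      two_local_automorphism witt_scale witt_bracket \<Phi> \<and>
      \<not> surj \<Phi> \<and>
      \<not> lie_automorphism witt_scale witt_bracket \<Phi>)"
proof (intro conjI allI impI)
  show "\<exists>!\<Phi> :: 'a witt \<Rightarrow> 'a witt. witt_shift \<Phi>"
    using witt_shift_exists witt_shift_unique by blast
next
  fix \<Phi> :: "'a witt \<Rightarrow> 'a witt"
  assume \<Phi>: "witt_shift \<Phi>"
  show two_local: "two_local_automorphism witt_scale witt_bracket \<Phi>"
    using \<Phi> by (rule witt_shift_two_local)
  then show "local_automorphism witt_scale witt_bracket \<Phi>"
    using \<Phi> unfolding local_automorphism_def two_local_automorphism_def witt_shift_def by blast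
  show not_surj: "\<not> surj \<Phi>"
    using \<Phi> by (rule witt_shift_not_surj)
  then show "\<not> lie_automorphism witt_scale witt_bracket \<Phi>"
    by (auto simp: lie_automorphism_def bij_is_surj)
qed

end
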